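(* Let $\phi\colon\mathbb{R}^2\to\mathbb{R}^{1+2}$, $\phi(s,t)=(t,\gamma(s,t))$, be an evolution by isothermal gauge for $C^1\times C^0$ initial data $(\mathcal{C},V)$, and let $U_0$ be the unit tangent along $\mathcal{C}$, with continuous angle function $\vartheta$. Suppose that $\mathrm{Im}(U_0)$ contains a closed semi-circle, i.e. suppose there exist $s_1<s_2$ such that $|\vartheta(s_2)-\vartheta(s_1)|\ge\pi$. Then $$\mathcal{K}_{\mathrm{sing}}\cap D(s_1,s_2)\neq\emptyset.$$
   Context: Initial data and evolution: $\mathcal{C}(s)=(0,c(s))$ and $V(s)=(1,v(s))$, where $c\colon\mathbb{R}\to\mathbb{R}^2$ is a $C^1$ immersion, $v\colon\mathbb{R}\to\mathbb{R}^2$ is continuous, and $\langle\dot c(s),v(s)\rangle=0$, $|\dot c(s)|^2+|v(s)|^2=1$ for all $s$ (so $|v|<1$). The evolution by isothermal gauge is $\phi(s,t)=(t,\gamma(s,t))$ with $$\gamma(s,t)=\tfrac12\Big(c(s+t)+c(s-t)+\int_{s-t}^{s+t}v(\zeta)\,d\zeta\Big).$$ $U_0(s)=\dot c(s)/|\dot c(s)|=(\cos\vartheta(s),\sin\vartheta(s))$ with $\vartheta\colon\mathbb{R}\to\mathbb{R}$ continuous. The singular set is $\mathcal{K}_{\mathrm{sing}}=\{(s,t)\in\mathbb{R}^2\colon\gamma_s(s,t)=0\}$, and $D(s_1,s_2)=\{(s,t)\in\mathbb{R}^2\colon s_1+|t|\le s\le s_2-|t|\}$. *)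

theory Defs
  imports "HOL-Analysis.Analysis"
begin

text \<open>Minkowski space of dimension 1+2 is \<open>real \<times> (real^2)\<close>, time component first. For
  initial data \<open>C\<close>, \<open>V\<close> the planar parts are \<open>c = snd \<circ> C\<close> and \<open>v = snd \<circ> V\<close>.\<close>

definition C1_C0_initial_data ::
    "(real \<Rightarrow> real \<times> (real^2)) \<Rightarrow> (real \<Rightarrow> real \<times> (real^2)) \<Rightarrow> bool" where
  "C1_C0_initial_data C V \<longleftrightarrow>
     (let c = (\<lambda>s. snd (C s)); v = (\<lambda>s. snd (V s)); c' = (\<lambda>s. vector_derivative c (at s)) in
        (\<forall>s. C s = (0, c s)) \<and> (\<forall>s. V s = (1, v s)) \<and>
        c C1_differentiable_on UNIV \<and> (\<forall>s. c' s \<noteq> 0) \<and>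
        continuous_on UNIV v \<and>
        (\<forall>s. c' s \<bullet> v s = 0) \<and> (\<forall>s. (norm (c' s))\<^sup>2 + (norm (v s))\<^sup>2 = 1))"

text \<open>The interval integral is oriented, so the formula is the intended one also for \<open>t < 0\<close>.\<close>

definition isothermal_evolution ::
    "(real \<Rightarrow> real \<times> (real^2)) \<Rightarrow> (real \<Rightarrow> real \<times> (real^2)) \<Rightarrow> real \<times> real \<Rightarrow> real \<times> (real^2)" where
  "isothermal_evolution C V =
     (let c = (\<lambda>s. snd (C s)); v = (\<lambda>s. snd (V s)) in
        (\<lambda>(s, t). (t, (1/2) *\<^sub>R (c (s + t) + c (s - t)
                     + (LBINT \<zeta>=ereal (s - t)..ereal (s + t). v \<zeta>)))))"

definition unit_tangent :: "(real \<Rightarrow> real \<times> (real^2)) \<Rightarrow> real \<Rightarrow> (real^2)" where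
  "unit_tangent C s =
     (let c' = vector_derivative (\<lambda>\<sigma>. snd (C \<sigma>)) (at s) in c' /\<^sub>R norm c')"

definition continuous_angle_function :: "(real \<Rightarrow> (real^2)) \<Rightarrow> (real \<Rightarrow> real) \<Rightarrow> bool" where
  "continuous_angle_function U \<theta> \<longleftrightarrow>
     continuous_on UNIV \<theta> \<and> (\<forall>s. U s = vector [cos (\<theta> s), sin (\<theta> s)])"

definition singular_set :: "(real \<times> real \<Rightarrow> real \<times> (real^2)) \<Rightarrow> (real \<times> real) set" where
  "singular_set \<phi> = {(s, t). ((\<lambda>\<sigma>. snd (\<phi> (\<sigma>, t))) has_vector_derivative 0) (at s)}"

definition dependence_domain :: "real \<Rightarrow> real \<Rightarrow> (real \<times> real) set" where
  "dependence_domain s\<^sub>1 s\<^sub>2 = {(s, t). s\<^sub>1 + \<bar>t\<bar> \<le> s \<and> s \<le> s\<^sub>2 - \<bar>t\<bar>}"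

end

theory Submission
  imports Defs
begin

text \<open>In null coordinates \<open>x = s + t\<close>, \<open>y = s - t\<close> one has
  \<open>2 \<gamma>\<^sub>s = (c' + v)(x) + (c' - v)(y)\<close>, and the domain of dependence of \<open>{s\<^sub>1..s\<^sub>2}\<close> is the
  square \<open>{s\<^sub>1..s\<^sub>2} \<times> {s\<^sub>1..s\<^sub>2}\<close>. Both \<open>c' \<plusminus> v\<close> are unit vectors, with continuous angles
  \<open>\<theta> \<plusminus> \<beta>\<close> where \<open>\<bar>\<beta>\<bar> < \<pi>/2\<close>, so \<open>\<gamma>\<^sub>s\<close> vanishes where
  \<open>F(x, y) = (\<theta> + \<beta>)(x) - (\<theta> - \<beta>)(y)\<close> equals \<open>\<plusminus>\<pi>\<close>. On the diagonal
  \<open>\<bar>F\<bar> = 2\<bar>\<beta>\<bar> < \<pi>\<close>, while at the off-diagonal corners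
  \<open>F = \<beta>(s\<^sub>1) + \<beta>(s\<^sub>2) \<plusminus> (\<theta>(s\<^sub>2) - \<theta>(s\<^sub>1))\<close>, so that \<open>\<bar>F\<bar> \<ge> \<pi>\<close> at one of them.\<close>

text \<open>Continuity of \<open>v\<close> gives an antiderivative \<open>W\<close> on the whole
  line. The oriented integral is then \<open>W (s + t) - W (s - t)\<close> for either sign of
  \<open>t\<close>, and the chain rule for shifts finishes.\<close>

lemma isothermal_evolution_has_vector_derivative:
  assumes c: "\<And>x. ((\<lambda>s. snd (C s)) has_vector_derivative c' x) (at x)"
    and v: "continuous_on UNIV (\<lambda>s. snd (V s))"
  shows "((\<lambda>\<sigma>. snd (isothermal_evolution C V (\<sigma>, t))) has_vector_derivative
    (1/2) *\<^sub>R (c' (s + t) + snd (V (s + t)) + (c' (s - t) - snd (V (s - t))))) (at s)"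
proof -
  define v where "v = (\<lambda>s. snd (V s))"
  have cont: "continuous_on UNIV v"
    using v by (simp add: v_def)
  have "\<exists>W. \<forall>x::real. -\<infinity> < ereal x \<longrightarrow> ereal x < \<infinity> \<longrightarrow> (W has_vector_derivative v x) (at x)"
    using cont
    by (intro einterval_antiderivative) (auto simp: continuous_on_eq_continuous_at)
  then obtain W where W: "\<And>x. (W has_vector_derivative v x) (at x)"
    by auto
  have FTC: "(LBINT \<zeta>=ereal a..ereal b. v \<zeta>) = W b - W a" for a b
    using cont W
    by (intro interval_integral_FTC_finite)
      (auto intro: continuous_on_subset has_vector_derivative_at_within)
  have shift: "((\<lambda>\<sigma>. f (\<sigma> + r)) has_vector_derivative f' (s + r)) (at s)"
    if "\<And>x. (f has_vector_derivative f' x) (at x)" for f f' :: "real \<Rightarrow> real^2" and r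
  proof -
    have "((\<lambda>\<sigma>. \<sigma> + r) has_vector_derivative 1) (at s)"
      by (auto intro!: derivative_eq_intros)
    from vector_diff_chain_at[OF this that] show ?thesis
      by (simp add: o_def)
  qed
  show ?thesis
    unfolding isothermal_evolution_def Let_def
    using shift[OF c, of t] shift[OF c, of "-t"] shift[OF W, of t] shift[OF W, of "-t"]
    by (auto simp: FTC[unfolded v_def] v_def algebra_simps intro!: derivative_eq_intros)
qed

text \<open>Orthogonality makes \<open>v\<close> a multiple q of the unit normal to
  \<open>p\<close>, and r^2 + q^2 = 1 with r > 0. So (r, q) = (cos \<beta>, sin \<beta>) for \<beta>
  = arcsin q, and the addition formulas apply.\<close>

lemma orthogonal_pair_polar:
  fixes p v :: "real^2"
  assumes p: "p = r *\<^sub>R vector [cos a, sin a]" and "r > 0"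
    and orth: "p \<bullet> v = 0" and norm: "(norm p)\<^sup>2 + (norm v)\<^sup>2 = 1"
  defines "\<beta> \<equiv> arcsin (v \<bullet> vector [- sin a, cos a])"
  shows "\<bar>v \<bullet> vector [- sin a, cos a]\<bar> < 1" and "\<bar>\<beta>\<bar> < pi / 2"
    and "p + v = vector [cos (a + \<beta>), sin (a + \<beta>)]"
    and "p - v = vector [cos (a - \<beta>), sin (a - \<beta>)]"
proof -
  define q where "q = v \<bullet> vector [- sin a, cos a]"
  have q: "q = - v$1 * sin a + v$2 * cos a"
    by (simp add: q_def inner_vec_def sum_2)
  have "r * (v$1 * cos a + v$2 * sin a) = 0"
    using orth by (simp add: p inner_vec_def sum_2 algebra_simps)
  then have 0: "v$1 * cos a + v$2 * sin a = 0"
    using \<open>r > 0\<close> by simp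
  have sc: "sin a * sin a + cos a * cos a = 1"
    using sin_cos_squared_add[of a] by (simp add: power2_eq_square)
  \<comment> \<open>The components of \<open>v\<close> along and normal to the direction
    \<open>a\<close> are 0 and \<open>q\<close>; rotating back by \<open>a\<close> recovers the
    coordinates.\<close>
  have v1: "v$1 = - q * sin a" and v2: "v$2 = q * cos a"
    using 0 sc unfolding q by algebra+
  have "(norm p)\<^sup>2 = r\<^sup>2"
    unfolding power2_norm_eq_inner p using sc
    by (simp add: inner_vec_def sum_2 power2_eq_square) algebra
  moreover have "(norm v)\<^sup>2 = q\<^sup>2"
    unfolding power2_norm_eq_inner using sc
    by (simp add: inner_vec_def sum_2 power2_eq_square v1 v2) algebra
  ultimately have r: "r\<^sup>2 = 1 - q\<^sup>2"
    using norm by simp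
  moreover have "r\<^sup>2 > 0"
    using \<open>r > 0\<close> by simp
  ultimately have "\<bar>q\<bar> < 1"
    by (simp add: abs_square_less_1)
  then show "\<bar>v \<bullet> vector [- sin a, cos a]\<bar> < 1"
    by (simp add: q_def)
  have \<beta>: "\<beta> = arcsin q"
    by (simp add: \<beta>_def q_def)
  show "\<bar>\<beta>\<bar> < pi / 2"
    using arcsin_lt_bounded[of q] \<open>\<bar>q\<bar> < 1\<close> unfolding \<beta> by linarith
  have "sin \<beta> = q"
    using \<open>\<bar>q\<bar> < 1\<close> by (auto simp: \<beta>)
  \<comment> \<open>The cosine of arcsin q is the nonnegative root of 1 - q^2 = r^2, which is
    \<open>r\<close> by positivity.\<close>
  moreover have "cos \<beta> = r"
    using \<open>\<bar>q\<bar> < 1\<close> \<open>r > 0\<close> by (simp add: \<beta> cos_arcsin flip: r)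
  ultimately show "p + v = vector [cos (a + \<beta>), sin (a + \<beta>)]"
    "p - v = vector [cos (a - \<beta>), sin (a - \<beta>)]"
    by (auto simp: vec_eq_iff forall_2 p v1 v2 cos_add sin_add cos_diff sin_diff)
qed

text \<open>Taking the modulus merges the targets pi and -pi, so one intermediate value argument on
  the connected square covers both directions of turning.\<close>

lemma angle_difference_attains_pi:
  fixes \<theta> \<beta> :: "real \<Rightarrow> real"
  assumes \<theta>: "continuous_on UNIV \<theta>" and \<beta>: "continuous_on UNIV \<beta>"
    and bound: "\<And>x. \<bar>\<beta> x\<bar> < pi / 2"
    and "s\<^sub>1 \<le> s\<^sub>2" and turn: "\<bar>\<theta> s\<^sub>2 - \<theta> s\<^sub>1\<bar> \<ge> pi"
  obtains x y where "x \<in> {s\<^sub>1..s\<^sub>2}" "y \<in> {s\<^sub>1..s\<^sub>2}"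
    "\<bar>(\<theta> x + \<beta> x) - (\<theta> y - \<beta> y)\<bar> = pi"
proof -
  define F where "F = (\<lambda>(x, y). \<bar>(\<theta> x + \<beta> x) - (\<theta> y - \<beta> y)\<bar>)"
  let ?S = "{s\<^sub>1..s\<^sub>2} \<times> {s\<^sub>1..s\<^sub>2}"
  have "continuous_on ?S F"
    unfolding F_def case_prod_beta
    by (intro continuous_intros continuous_on_compose2[OF \<theta>] continuous_on_compose2[OF \<beta>]) auto
  moreover have "connected ?S"
    by (intro connected_Times) auto
  ultimately have conn: "connected (F ` ?S)"
    by (rule connected_continuous_image)
  have "F (s\<^sub>1, s\<^sub>1) \<le> pi"
    using bound[of s\<^sub>1] by (simp add: F_def)
  moreover have "\<exists>z\<in>?S. pi \<le> F z"
  proof -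
    \<comment> \<open>Without the modulus the two values are b - d and b + d, where d is the
      increment of \<theta> and b the sum of \<beta> at the two ends. The larger modulus is |b| +
      |d|, at least pi.\<close>
    have "pi \<le> F (s\<^sub>1, s\<^sub>2) \<or> pi \<le> F (s\<^sub>2, s\<^sub>1)"
      using turn by (auto simp: F_def)
    moreover have "(s\<^sub>1, s\<^sub>2) \<in> ?S" "(s\<^sub>2, s\<^sub>1) \<in> ?S"
      using \<open>s\<^sub>1 \<le> s\<^sub>2\<close> by auto
    ultimately show ?thesis
      by blast
  qed
  moreover have "(s\<^sub>1, s\<^sub>1) \<in> ?S"
    using \<open>s\<^sub>1 \<le> s\<^sub>2\<close> by auto
  ultimately have "pi \<in> F ` ?S"
    using connectedD_interval[OF conn] by blast
  then show thesis
    using that by (auto simp: F_def)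
qed

lemma antipodal_direction_vectors:
  assumes "\<bar>a - b\<bar> = pi"
  shows "vector [cos a, sin a] + vector [cos b, sin b] = (0 :: real^2)"
proof -
  have "a = b + pi \<or> a = b - pi"
    using assms by linarith
  then show ?thesis
    by (auto simp: vec_eq_iff forall_2)
qed

theorem proposition5p4:
  fixes C V :: "real \<Rightarrow> real \<times> (real^2)"
    and \<phi> :: "real \<times> real \<Rightarrow> real \<times> (real^2)"
    and U\<^sub>0 :: "real \<Rightarrow> real^2"
    and \<theta> :: "real \<Rightarrow> real"
    and s\<^sub>1 s\<^sub>2 :: real
  assumes "C1_C0_initial_data C V"
    and "\<phi> = isothermal_evolution C V"
    and "U\<^sub>0 = unit_tangent C"
    and "continuous_angle_function U\<^sub>0 \<theta>"
    and "s\<^sub>1 < s\<^sub>2"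
    and "\<bar>\<theta> s\<^sub>2 - \<theta> s\<^sub>1\<bar> \<ge> pi"
  shows "singular_set \<phi> \<inter> dependence_domain s\<^sub>1 s\<^sub>2 \<noteq> {}"
proof -
  define v where "v = (\<lambda>s. snd (V s))"
  define c' where "c' = (\<lambda>s. vector_derivative (\<lambda>\<sigma>. snd (C \<sigma>)) (at s))"
  \<comment> \<open>This explicit choice of angle inherits continuity from \<open>v\<close> and
    \<theta>, so no lifting argument is required for \<open>c' + v\<close> and
    \<open>c' - v\<close>.\<close>
  define \<beta> where "\<beta> = (\<lambda>s. arcsin (v s \<bullet> vector [- sin (\<theta> s), cos (\<theta> s)]))"
  have data: "(\<lambda>s. snd (C s)) C1_differentiable_on UNIV" "\<And>s. c' s \<noteq> 0" "continuous_on UNIV v"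
    "\<And>s. c' s \<bullet> v s = 0" "\<And>s. (norm (c' s))\<^sup>2 + (norm (v s))\<^sup>2 = 1"
    using assms(1) by (simp_all add: C1_C0_initial_data_def Let_def v_def c'_def)
  have \<theta>: "continuous_on UNIV \<theta>"
    and U: "c' s /\<^sub>R norm (c' s) = vector [cos (\<theta> s), sin (\<theta> s)]" for s
    using assms(3,4)
    by (simp_all add: continuous_angle_function_def unit_tangent_def Let_def c'_def)
  have "c' s = norm (c' s) *\<^sub>R vector [cos (\<theta> s), sin (\<theta> s)]" for s
    unfolding U[symmetric] using data(2)[of s] by simp
  moreover have "norm (c' s) > 0" for s
    using data(2) by simp
  ultimately have polar: "\<bar>v s \<bullet> vector [- sin (\<theta> s), cos (\<theta> s)]\<bar> < 1" "\<bar>\<beta> s\<bar> < pi / 2"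
    "c' s + v s = vector [cos (\<theta> s + \<beta> s), sin (\<theta> s + \<beta> s)]"
    "c' s - v s = vector [cos (\<theta> s - \<beta> s), sin (\<theta> s - \<beta> s)]" for s
    using orthogonal_pair_polar[of "c' s" "norm (c' s)" "\<theta> s" "v s", OF _ _ data(4,5)]
    by (simp_all add: \<beta>_def)
  have "continuous_on UNIV (\<lambda>s. v s \<bullet> vector [- sin (\<theta> s), cos (\<theta> s)])"
    unfolding inner_vec_def sum_2 using data(3) \<theta> by (auto intro!: continuous_intros)
  moreover have "\<forall>s\<in>UNIV. - 1 \<le> v s \<bullet> vector [- sin (\<theta> s), cos (\<theta> s)] \<and>
      v s \<bullet> vector [- sin (\<theta> s), cos (\<theta> s)] \<le> 1"
    using polar(1) by (meson abs_le_iff less_imp_le minus_le_iff)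
  ultimately have \<beta>: "continuous_on UNIV \<beta>"
    unfolding \<beta>_def
    by (rule continuous_on_arcsin)
  obtain x y where xy: "x \<in> {s\<^sub>1..s\<^sub>2}" "y \<in> {s\<^sub>1..s\<^sub>2}"
    and pi: "\<bar>(\<theta> x + \<beta> x) - (\<theta> y - \<beta> y)\<bar> = pi"
    using angle_difference_attains_pi[OF \<theta> \<beta> polar(2) less_imp_le[OF assms(5)] assms(6)] .
  define s t where "s = (x + y) / 2" and "t = (x - y) / 2"
  have st: "s + t = x" "s - t = y"
    by (simp_all add: s_def t_def field_simps)
  have "(c' x + v x) + (c' y - v y) = 0"
    unfolding polar(3,4) by (rule antipodal_direction_vectors[OF pi])
  moreover have "((\<lambda>s. snd (C s)) has_vector_derivative c' u) (at u)" for u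
    using data(1)
    by (simp add: c'_def C1_differentiable_on_eq vector_derivative_works)
  from isothermal_evolution_has_vector_derivative[of C c' V t s, OF this data(3)[unfolded v_def]]
  have "((\<lambda>\<sigma>. snd (\<phi> (\<sigma>, t))) has_vector_derivative
      (1/2) *\<^sub>R ((c' x + v x) + (c' y - v y))) (at s)"
    by (simp add: assms(2) st v_def)
  ultimately have "(s, t) \<in> singular_set \<phi>"
    by (simp add: singular_set_def)
  \<comment> \<open>Here s + |t| and s - |t| are the maximum and minimum of \<open>x\<close> and
    \<open>y\<close>, so the domain condition says that both lie between the endpoints.\<close>
  moreover have "(s, t) \<in> dependence_domain s\<^sub>1 s\<^sub>2"
    using xy unfolding dependence_domain_def st[symmetric] by auto
  ultimately show ?thesis
    by blast
qed

end
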